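(* Let $r$ be an integer such that $r+2$ is odd and $r+2>3$. Suppose that there exists a finite projective plane of order $r+2$ that contains an oval, that is, a set of $r+3$ points no three of which are collinear. Then there exists an $(r,r+2;6)$-babi-graph of order $2(r^2+3r+2)$.
   Context: Graphs are finite and simple. The girth of a graph is the length of its shortest cycle; the order of a graph is its number of vertices. For integers $1\leq r\leq s$ and $g\geq 3$, an $(r,s;g)$-balanced biregular graph (for short, $(r,s;g)$-babi-graph) is a graph of girth $g$ whose set of vertex degrees equals $\{r,s\}$ and in which the number of vertices of degree $r$ equals the number of vertices of degree $s$. A finite projective plane of order $q$ is an incidence structure with $q^2+q+1$ points and $q^2+q+1$ lines such that any two distinct points are incident with precisely one common line, any two distinct lines are incident with precisely one common point, each line is incident with exactly $q+1$ points, and each point is incident with exactly $q+1$ lines. Points are collinear if they are incident with a common line. *)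

theory Defs
  imports "Graph_Theory.Arc_Walk" "HOL-Library.Extended_Nat"
begin

text \<open>
  A finite simple graph is a \<^locale>\<open>graph\<close> in the sense of Graph_Theory, that is, a finite
  symmetric digraph without loops or parallel arcs: an undirected edge is a pair of opposite arcs,
  and \<^const>\<open>out_degree\<close> is the usual vertex degree. The directed notion of cycle also admits
  \<open>u, v, u\<close> along the two arcs of a single edge; the cycles of the undirected graph are exactly the
  directed cycles of length at least 3. The girth of an acyclic graph is \<open>\<infinity>\<close>.
\<close>

definition girth :: "('a, 'b) pre_digraph \<Rightarrow> enat" where
  "girth G = (INF p \<in> {p. pre_digraph.cycle G p \<and> 3 \<le> length p}. enat (length p))"

definition order :: "('a, 'b) pre_digraph \<Rightarrow> nat" where
  "order G = card (verts G)"

definition babi_graph :: "nat \<Rightarrow> nat \<Rightarrow> nat \<Rightarrow> ('a, 'b) pre_digraph \<Rightarrow> bool" where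
  "babi_graph r s g G \<longleftrightarrow>
     1 \<le> r \<and> r \<le> s \<and> 3 \<le> g \<and>
     graph G \<and>
     girth G = enat g \<and>
     out_degree G ` verts G = {r, s} \<and>
     card {v \<in> verts G. out_degree G v = r} = card {v \<in> verts G. out_degree G v = s}"

text \<open>Finiteness of the sets of points and lines follows from their cardinalities being positive.\<close>

locale projective_plane =
  fixes points :: "'p set" and lines :: "'l set"
    and incident :: "'p \<Rightarrow> 'l \<Rightarrow> bool" and q :: nat
  assumes card_points: "card points = q\<^sup>2 + q + 1"
    and card_lines: "card lines = q\<^sup>2 + q + 1"
    and unique_line: "\<lbrakk>x \<in> points; y \<in> points; x \<noteq> y\<rbrakk>
          \<Longrightarrow> \<exists>!l. l \<in> lines \<and> incident x l \<and> incident y l"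
    and unique_point: "\<lbrakk>l \<in> lines; m \<in> lines; l \<noteq> m\<rbrakk>
          \<Longrightarrow> \<exists>!x. x \<in> points \<and> incident x l \<and> incident x m"
    and card_points_on_line: "l \<in> lines \<Longrightarrow> card {x \<in> points. incident x l} = q + 1"
    and card_lines_through_point: "x \<in> points \<Longrightarrow> card {l \<in> lines. incident x l} = q + 1"

definition collinear :: "'l set \<Rightarrow> ('p \<Rightarrow> 'l \<Rightarrow> bool) \<Rightarrow> 'p set \<Rightarrow> bool" where
  "collinear lines incident S \<longleftrightarrow> (\<exists>l\<in>lines. \<forall>x\<in>S. incident x l)"

definition oval :: "'p set \<Rightarrow> 'l set \<Rightarrow> ('p \<Rightarrow> 'l \<Rightarrow> bool) \<Rightarrow> nat \<Rightarrow> 'p set \<Rightarrow> bool" where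
  "oval points lines incident q Q \<longleftrightarrow>
     Q \<subseteq> points \<and> card Q = q + 1 \<and>
     (\<forall>S. S \<subseteq> Q \<and> card S = 3 \<longrightarrow> \<not> collinear lines incident S)"

end

theory Submission
  imports Defs
begin

text \<open>
  Write \<open>q = r + 2\<close>. The graph is the incidence graph of what remains of the plane after deleting
  \<open>2q + 1\<close> points and \<open>2q + 1\<close> lines. Choose a point \<open>P\<close> of the oval \<open>Q\<close> and let \<open>T\<close> be the tangent
  of \<open>Q\<close> at \<open>P\<close>. Deleted are the points of \<open>Q\<close> and of \<open>T\<close>, and the tangents of \<open>Q\<close> together with
  the lines through \<open>P\<close>.

  A remaining line meets \<open>T\<close> in one deleted point outside \<open>Q\<close>, and it meets \<open>Q\<close> in 0 or 2 points,
  because it is not a tangent. It therefore keeps \<open>q\<close> or \<open>q - 2\<close> of its \<open>q + 1\<close> points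
  (\<open>degree_kept_line\<close>). Every point of \<open>Q\<close> other than \<open>P\<close> lies on \<open>q - 1\<close> remaining lines, so a
  double count gives \<open>q(q - 1)/2\<close> remaining secants. This is half of all the remaining lines, so the
  other half misses \<open>Q\<close> (\<open>card_kept_secants_passants\<close>).

  The statements about points are the same statements in the dual plane. For odd \<open>q\<close> every point off
  the oval lies on 0 or 2 tangents (\<open>card_tangents_off_oval\<close>). Hence the tangents form an oval of the
  dual plane whose own tangents are the points of \<open>Q\<close>, and duality exchanges \<open>P\<close> with \<open>T\<close> and the
  deleted points with the deleted lines (\<open>dual_flag\<close>).

  Two points have only one common line, so the bipartite incidence graph has no 4-cycle and its girth
  is at least 6. A 6-cycle is a triangle of remaining points and lines, and it is found
  greedily (\<open>kept_triangle\<close>).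
\<close>

section \<open>Incidence graphs of partial linear spaces\<close>

text \<open>
  Points and lines are placed on vertices by two maps \<open>f\<close> and \<open>g\<close> into an arbitrary vertex type;
  this makes it possible to realise the graph directly on the natural numbers.
\<close>

definition incidence_graph ::
  "'p set \<Rightarrow> 'l set \<Rightarrow> ('p \<Rightarrow> 'l \<Rightarrow> bool) \<Rightarrow> ('p \<Rightarrow> 'v) \<Rightarrow> ('l \<Rightarrow> 'v) \<Rightarrow> ('v, 'v \<times> 'v) pre_digraph"
where
  "incidence_graph X L I f g = \<lparr>
     verts = f ` X \<union> g ` L,
     arcs = {(f x, g l) | x l. x \<in> X \<and> l \<in> L \<and> I x l} \<union> {(g l, f x) | x l. x \<in> X \<and> l \<in> L \<and> I x l},
     tail = fst, head = snd \<rparr>"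

locale finite_incidence =
  fixes X :: "'p set" and L :: "'l set" and I :: "'p \<Rightarrow> 'l \<Rightarrow> bool"
    and f :: "'p \<Rightarrow> 'v" and g :: "'l \<Rightarrow> 'v"
  assumes finite_X: "finite X" and finite_L: "finite L"
    and inj_f: "inj_on f X" and inj_g: "inj_on g L"
    and disjoint: "f ` X \<inter> g ` L = {}"
begin

abbreviation "G \<equiv> incidence_graph X L I f g"

lemma verts_eq: "verts G = f ` X \<union> g ` L"
  by (simp add: incidence_graph_def)

lemma tail_eq: "tail G = fst" and head_eq: "head G = snd"
  by (simp_all add: incidence_graph_def)

lemma f_neq_g: "x \<in> X \<Longrightarrow> l \<in> L \<Longrightarrow> f x \<noteq> g l"
  using disjoint by blast

lemma arc_cases:
  assumes "e \<in> arcs G"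
  obtains (point_line) x l where "x \<in> X" "l \<in> L" "I x l" "e = (f x, g l)"
  | (line_point) x l where "x \<in> X" "l \<in> L" "I x l" "e = (g l, f x)"
  using assms by (auto simp: incidence_graph_def)

lemma point_line_arc_iff:
  "x \<in> X \<Longrightarrow> l \<in> L \<Longrightarrow> (f x, g l) \<in> arcs G \<longleftrightarrow> I x l"
  "x \<in> X \<Longrightarrow> l \<in> L \<Longrightarrow> (g l, f x) \<in> arcs G \<longleftrightarrow> I x l"
  using f_neq_g inj_f inj_g by (auto simp: incidence_graph_def dest: inj_onD)

text \<open>Consequently no closed walk has odd length.\<close>

lemma arc_sides: "(u, v) \<in> arcs G \<Longrightarrow> u \<in> f ` X \<longleftrightarrow> v \<notin> f ` X"
  using f_neq_g by (auto simp: incidence_graph_def) (metis f_neq_g)+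

lemma arc_sym: "(u, v) \<in> arcs G \<longleftrightarrow> (v, u) \<in> arcs G"
  by (auto simp: incidence_graph_def)

lemma graph: "graph G"
proof -
  have "arcs G \<subseteq> verts G \<times> verts G"
    by (auto simp: incidence_graph_def)
  moreover have "finite (verts G)"
    using finite_X finite_L by (simp add: incidence_graph_def)
  ultimately have "finite (arcs G)"
    by (meson finite_SigmaI finite_subset)
  then interpret digraph G
    using finite_X finite_L f_neq_g
    by unfold_locales (auto simp: incidence_graph_def arc_to_ends_def, metis+)
  have "symmetric G"
    by (auto simp: symmetric_conv tail_eq head_eq intro: bexI[OF _ iffD1[OF arc_sym]])
  then show ?thesis by (rule graphI)
qed

lemma out_degree_point:
  assumes "x \<in> X"
  shows "out_degree G (f x) = card {l \<in> L. I x l}"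
proof -
  have "e \<in> (\<lambda>l. (f x, g l)) ` {l \<in> L. I x l}" if "e \<in> arcs G" "fst e = f x" for e
    using that(1)
  proof (cases rule: arc_cases)
    case (point_line y l)
    then show ?thesis using that(2) assms inj_f by (auto dest: inj_onD)
  next
    case (line_point y l)
    then show ?thesis using that(2) assms f_neq_g by fastforce
  qed
  then have "out_arcs G (f x) = (\<lambda>l. (f x, g l)) ` {l \<in> L. I x l}"
    using assms by (auto simp: out_arcs_def point_line_arc_iff tail_eq)
  moreover have "inj_on (\<lambda>l. (f x, g l)) {l \<in> L. I x l}"
    using inj_g by (auto simp: inj_on_def)
  ultimately show ?thesis
    by (simp add: out_degree_def card_image)
qed

lemma out_degree_line:
  assumes "l \<in> L"
  shows "out_degree G (g l) = card {x \<in> X. I x l}"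
proof -
  have "e \<in> (\<lambda>x. (g l, f x)) ` {x \<in> X. I x l}" if "e \<in> arcs G" "fst e = g l" for e
    using that(1)
  proof (cases rule: arc_cases)
    case (point_line x m)
    then show ?thesis using that(2) assms f_neq_g by fastforce
  next
    case (line_point x m)
    then show ?thesis using that(2) assms inj_g by (auto dest: inj_onD)
  qed
  then have "out_arcs G (g l) = (\<lambda>x. (g l, f x)) ` {x \<in> X. I x l}"
    using assms by (auto simp: out_arcs_def point_line_arc_iff tail_eq)
  moreover have "inj_on (\<lambda>x. (g l, f x)) {x \<in> X. I x l}"
    using inj_f by (auto simp: inj_on_def)
  ultimately show ?thesis
    by (simp add: out_degree_def card_image)
qed

lemma out_degree_image:
  "out_degree G ` verts G = (\<lambda>x. card {l \<in> L. I x l}) ` X \<union> (\<lambda>l. card {x \<in> X. I x l}) ` L"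
proof -
  have "out_degree G ` verts G = (\<lambda>x. out_degree G (f x)) ` X \<union> (\<lambda>l. out_degree G (g l)) ` L"
    by (auto simp: incidence_graph_def)
  then show ?thesis
    by (simp add: out_degree_point out_degree_line cong: image_cong)
qed

lemma card_vertices_of_degree:
  "card {v \<in> verts G. out_degree G v = d} =
   card {x \<in> X. card {l \<in> L. I x l} = d} + card {l \<in> L. card {x \<in> X. I x l} = d}"
  (is "_ = card ?A + card ?B")
proof -
  have eq: "{v \<in> verts G. out_degree G v = d} = f ` ?A \<union> g ` ?B"
    by (auto simp: verts_eq out_degree_point out_degree_line)
  have "card (f ` ?A \<union> g ` ?B) = card (f ` ?A) + card (g ` ?B)"
    using finite_X finite_L disjoint by (intro card_Un_disjoint) auto
  moreover have "card (f ` ?A) = card ?A" "card (g ` ?B) = card ?B"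
    using inj_f inj_g by (auto intro!: card_image elim: inj_on_subset)
  ultimately show ?thesis
    using eq by simp
qed

lemma order: "order G = card X + card L"
  using finite_X finite_L disjoint inj_f inj_g
  by (simp add: order_def incidence_graph_def card_Un_disjoint card_image)

text \<open>
  A 4-cycle through a point vertex \<open>a\<close> would consist of two points and two lines through both of
  them. One that starts at a line vertex is rotated by one step.
\<close>

lemma no_quadrangle:
  assumes partial_linear: "\<And>x y l m. \<lbrakk>x \<in> X; y \<in> X; l \<in> L; m \<in> L;
      I x l; I y l; I x m; I y m\<rbrakk> \<Longrightarrow> x = y \<or> l = m"
    and arcs: "(a, b) \<in> arcs G" "(b, c) \<in> arcs G" "(c, d) \<in> arcs G" "(d, a) \<in> arcs G"
  shows "a = c \<or> b = d"
proof -
  have main: "a = c \<or> b = d" if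
    arcs: "(a, b) \<in> arcs G" "(b, c) \<in> arcs G" "(c, d) \<in> arcs G" "(d, a) \<in> arcs G"
    and a: "a \<in> f ` X" for a b c d
  proof -
    have "c \<in> f ` X" "b \<notin> f ` X" "d \<notin> f ` X"
      using arcs a arc_sides by blast+
    moreover have "v \<in> verts G" if "(u, v) \<in> arcs G" for u v
      using that by (auto simp: incidence_graph_def)
    ultimately obtain x y l m where "x \<in> X" "y \<in> X" "l \<in> L" "m \<in> L"
      "a = f x" "c = f y" "b = g l" "d = g m"
      using arcs a by (fastforce simp: incidence_graph_def)
    then show ?thesis
      using arcs partial_linear by (metis point_line_arc_iff)
  qed
  show ?thesis
  proof (cases "a \<in> f ` X")
    case True
    then show ?thesis using main arcs by blast
  next
    case False
    then have "b \<in> f ` X" using arcs arc_sides by blast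
    then show ?thesis using main[of b c d a] arcs by blast
  qed
qed

text \<open>
  Lengths 3 and 5 are excluded by the bipartition and length 4 by partial linearity; the 6-cycle runs
  around a triangle with vertices \<open>x\<close>, \<open>y\<close>, \<open>z\<close> and opposite sides \<open>k\<close>, \<open>m\<close>, \<open>l\<close>.
\<close>

lemma girth_eq_6:
  assumes partial_linear: "\<And>x y l m. \<lbrakk>x \<in> X; y \<in> X; l \<in> L; m \<in> L;
      I x l; I y l; I x m; I y m\<rbrakk> \<Longrightarrow> x = y \<or> l = m"
    and triangle: "x \<in> X" "y \<in> X" "z \<in> X" "k \<in> L" "l \<in> L" "m \<in> L"
      "x \<noteq> y" "y \<noteq> z" "z \<noteq> x" "k \<noteq> l" "l \<noteq> m" "m \<noteq> k"
      "I x l" "I y l" "I y k" "I z k" "I z m" "I x m"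
  shows "girth G = 6"
proof (rule antisym)
  let ?p = "[(f x, g l), (g l, f y), (f y, g k), (g k, f z), (f z, g m), (g m, f x)]"
  have "pre_digraph.cycle G ?p"
    unfolding pre_digraph.cycle_def
  proof (intro exI conjI)
    show "pre_digraph.awalk G (f x) ?p (f x)"
      using triangle
      by (auto simp: pre_digraph.awalk_def pre_digraph.cas.simps incidence_graph_def)
    show "distinct (tl (pre_digraph.awalk_verts G (f x) ?p))"
      using triangle
      by (simp add: pre_digraph.awalk_verts.simps tail_eq head_eq f_neq_g f_neq_g[symmetric]
          inj_on_eq_iff[OF inj_f] inj_on_eq_iff[OF inj_g])
  qed simp
  then have "girth G \<le> enat (length ?p)"
    unfolding girth_def by (intro INF_lower) simp
  then show "girth G \<le> 6"
    by (simp add: numeral_eq_enat eval_nat_numeral)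
next
  have "6 \<le> length p" if cyc: "pre_digraph.cycle G p" and len: "3 \<le> length p" for p
  proof (rule ccontr)
    assume "\<not> 6 \<le> length p"
    with len consider "length p = 3" | "length p = 4" | "length p = 5" by linarith
    moreover obtain u where u: "pre_digraph.awalk G u p u" 
        "distinct (tl (pre_digraph.awalk_verts G u p))"
      using cyc by (auto simp: pre_digraph.cycle_def)
    note walk = pre_digraph.awalk_def pre_digraph.cas.simps pre_digraph.awalk_verts.simps tail_eq head_eq
    ultimately show False
    proof cases
      case 1
      then obtain a b c where "(a, b) \<in> arcs G" "(b, c) \<in> arcs G" "(c, a) \<in> arcs G"
        using u by (auto simp: numeral_eq_Suc length_Suc_conv walk)
      then show False
        using arc_sides by blast
    next
      case 2
      then obtain a b c d where "(a, b) \<in> arcs G" "(b, c) \<in> arcs G" "(c, d) \<in> arcs G"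
        "(d, a) \<in> arcs G" "a \<noteq> c" "b \<noteq> d"
        using u by (auto simp: numeral_eq_Suc length_Suc_conv walk)
      then show False
        using no_quadrangle[OF partial_linear] by blast
    next
      case 3
      then obtain a b c d e where "(a, b) \<in> arcs G" "(b, c) \<in> arcs G" "(c, d) \<in> arcs G"
        "(d, e) \<in> arcs G" "(e, a) \<in> arcs G"
        using u by (auto simp: numeral_eq_Suc length_Suc_conv walk)
      then show False
        using arc_sides by blast
    qed
  qed
  then show "6 \<le> girth G"
    unfolding girth_def by (intro INF_greatest) (auto simp: numeral_eq_enat)
qed

end

section \<open>Ovals in projective planes of odd order\<close>

context projective_plane
begin

lemma dual: "projective_plane lines points (\<lambda>l x. incident x l) q"
  by (rule projective_plane.intro[OF card_lines card_points unique_point unique_line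
    card_lines_through_point card_points_on_line])

lemma finite_points: "finite points" and finite_lines: "finite lines"
  using card_points card_lines by (auto intro: card_ge_0_finite)

lemma partial_linear:
  "\<lbrakk>x \<in> points; y \<in> points; l \<in> lines; m \<in> lines;
    incident x l; incident y l; incident x m; incident y m\<rbrakk> \<Longrightarrow> x = y \<or> l = m"
  using unique_line by blast

lemma card_common_lines:
  assumes "x \<in> points" "y \<in> points" "x \<noteq> y"
  shows "card {l \<in> lines. incident x l \<and> incident y l} = 1"
proof -
  obtain l where "{l \<in> lines. incident x l \<and> incident y l} = {l}"
    using unique_line[OF assms] by auto
  then show ?thesis by simp
qed

end

locale odd_oval = projective_plane points lines incident q
  for points :: "'p set" and lines :: "'l set" and incident and q +
  fixes Q :: "'p set"
  assumes oval: "oval points lines incident q Q" and odd_order: "odd q"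
begin

definition tangents :: "'l set" where
  "tangents = {l \<in> lines. card {x \<in> Q. incident x l} = 1}"

lemma oval_points: "Q \<subseteq> points" and card_oval: "card Q = q + 1"
  using oval by (auto simp: oval_def)

lemma finite_oval: "finite Q"
  using oval_points finite_points finite_subset by blast

lemma finite_tangents: "finite tangents"
  using finite_lines by (simp add: tangents_def)

lemma tangency_point_unique:
  assumes "t \<in> tangents" "A \<in> Q" "B \<in> Q" "incident A t" "incident B t"
  shows "A = B"
proof -
  obtain C where "{x \<in> Q. incident x t} = {C}"
    using assms(1) by (auto simp: tangents_def card_1_singleton_iff)
  moreover have "A \<in> {x \<in> Q. incident x t}" "B \<in> {x \<in> Q. incident x t}"
    using assms by auto
  ultimately show ?thesis by simp
qed

lemma line_meets_oval:
  assumes "l \<in> lines"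
  shows "card {x \<in> Q. incident x l} \<le> 2"
proof (rule ccontr)
  assume "\<not> ?thesis"
  then have "3 \<le> card {x \<in> Q. incident x l}" by simp
  then obtain S where "S \<subseteq> {x \<in> Q. incident x l}" "card S = 3"
    by (rule obtain_subset_with_card_n)
  moreover from this have "S \<subseteq> Q" "collinear lines incident S"
    using assms by (auto simp: collinear_def)
  ultimately show False
    using oval by (auto simp: oval_def)
qed

lemma nontangent_meets_oval:
  assumes "l \<in> lines" "l \<notin> tangents"
  shows "card {x \<in> Q. incident x l} \<in> {0, 2}"
  using line_meets_oval[OF assms(1)] assms by (auto simp: tangents_def)

text \<open>
  The \<open>q\<close> other points of the oval are distributed over the \<open>q + 1\<close> lines through \<open>A\<close>, at most one on
  each line, so exactly one line through \<open>A\<close> receives none.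
\<close>

lemma card_tangents_at_oval_point:
  assumes A: "A \<in> Q"
  shows "card {t \<in> tangents. incident A t} = 1"
proof -
  let ?pencil = "{l \<in> lines. incident A l}"
  have A_pt: "A \<in> points" using A oval_points by blast
  have fin: "finite ?pencil" using finite_lines by simp
  have "(\<Sum>l\<in>?pencil. card {B \<in> Q - {A}. incident B l}) = 1 * card (Q - {A})"
  proof (rule sum_multicount[OF fin])
    show "\<forall>B\<in>Q - {A}. card {l \<in> ?pencil. incident B l} = 1"
    proof
      fix B assume "B \<in> Q - {A}"
      then show "card {l \<in> ?pencil. incident B l} = 1"
        using card_common_lines[of A B] A_pt oval_points by (auto simp: conj_assoc)
    qed
  qed (use finite_oval in simp)
  also have "\<dots> = q" using A card_oval finite_oval by simp
  also have "(\<Sum>l\<in>?pencil. card {B \<in> Q - {A}. incident B l}) =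
      (\<Sum>l\<in>?pencil. if l \<in> tangents then 0 else 1)"
  proof (rule sum.cong[OF refl])
    fix l assume l: "l \<in> ?pencil"
    have "{B \<in> Q - {A}. incident B l} = {B \<in> Q. incident B l} - {A}" by blast
    moreover have "A \<in> {B \<in> Q. incident B l}" using A l by blast
    ultimately have "card {B \<in> Q. incident B l} = Suc (card {B \<in> Q - {A}. incident B l})"
      using card.remove[of "{B \<in> Q. incident B l}" A] finite_oval by simp
    then show "card {B \<in> Q - {A}. incident B l} = (if l \<in> tangents then 0 else 1)"
      using l line_meets_oval[of l] by (auto simp: tangents_def)
  qed
  also have "\<dots> = card {l \<in> ?pencil. l \<notin> tangents}"
    using fin by (simp add: sum.If_cases Int_def)
  finally have "card {l \<in> ?pencil. l \<notin> tangents} = q" .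
  moreover have "card ?pencil = card {l \<in> ?pencil. l \<notin> tangents} + card {t \<in> tangents. incident A t}"
  proof -
    have "?pencil = {l \<in> ?pencil. l \<notin> tangents} \<union> {t \<in> tangents. incident A t}"
      by (auto simp: tangents_def)
    also have "card \<dots> = card {l \<in> ?pencil. l \<notin> tangents} + card {t \<in> tangents. incident A t}"
      using finite_lines finite_tangents by (intro card_Un_disjoint) auto
    finally show ?thesis .
  qed
  ultimately show ?thesis
    using card_lines_through_point[OF A_pt] by simp
qed

lemma card_tangents: "card tangents = q + 1"
proof -
  have "(\<Sum>t\<in>tangents. card {A \<in> Q. incident A t}) = 1 * card Q"
    using card_tangents_at_oval_point finite_tangents finite_oval
    by (intro sum_multicount) auto
  then show ?thesis
    using card_oval by (simp add: tangents_def)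
qed

text \<open>
  The lines through \<open>x\<close> partition the oval, which has an even number \<open>q + 1\<close> of points. The parts of
  odd size are cut out by the tangents, so their number is even.
\<close>

lemma even_card_tangents_off_oval:
  assumes x: "x \<in> points" "x \<notin> Q"
  shows "even (card {t \<in> tangents. incident x t})"
proof -
  let ?pencil = "{l \<in> lines. incident x l}"
  have fin: "finite ?pencil" using finite_lines by simp
  have "(\<Sum>l\<in>?pencil. card {A \<in> Q. incident A l}) = 1 * card Q"
  proof (rule sum_multicount[OF fin finite_oval], rule ballI)
    fix A assume "A \<in> Q"
    then have "card {l \<in> lines. incident x l \<and> incident A l} = 1"
      using x oval_points by (intro card_common_lines) auto
    then show "card {l \<in> ?pencil. incident A l} = 1" by (simp add: conj_assoc)
  qed
  then have "even (\<Sum>l\<in>?pencil. card {A \<in> Q. incident A l})"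
    using card_oval odd_order by simp
  then have "even (card {l \<in> ?pencil. odd (card {A \<in> Q. incident A l})})"
    using fin by (simp add: even_sum_iff)
  also have "{l \<in> ?pencil. odd (card {A \<in> Q. incident A l})} = {t \<in> tangents. incident x t}"
    using nontangent_meets_oval by (force simp: tangents_def)
  finally show ?thesis .
qed

text \<open>
  Suppose that \<open>x\<close> lies on a tangent \<open>t\<close>, which touches the oval at \<open>A\<close>. The \<open>q\<close> other tangents meet
  \<open>t\<close> in its \<open>q\<close> points different from \<open>A\<close>, and by parity each of these points receives at least one
  of them. Hence each of these points, and \<open>x\<close> in particular, receives exactly one.
\<close>

lemma card_tangents_off_oval:
  assumes x: "x \<in> points" "x \<notin> Q"
  shows "card {t \<in> tangents. incident x t} \<in> {0, 2}"
proof (cases "{t \<in> tangents. incident x t} = {}")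
  case True
  then show ?thesis by (simp only: card.empty) simp
next
  case False
  then obtain t where t: "t \<in> tangents" "incident x t" by blast
  then have t_line: "t \<in> lines" by (simp add: tangents_def)
  obtain A where A: "{y \<in> Q. incident y t} = {A}"
    using t(1) by (auto simp: tangents_def card_1_singleton_iff)
  let ?Y = "{y \<in> points. incident y t} - {A}"
  let ?others = "\<lambda>y. {s \<in> tangents - {t}. incident y s}"
  have finY: "finite ?Y" using finite_points by simp
  have A_pt: "A \<in> points" using A oval_points by blast
  have cardY: "card ?Y = q"
  proof -
    have "A \<in> {y \<in> points. incident y t}" using A A_pt by blast
    then show ?thesis using card_points_on_line[OF t_line] by (simp add: card_Diff_singleton)
  qed
  have A_only: "\<not> incident A s" if "s \<in> tangents - {t}" for s
  proof
    assume "incident A s"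
    then have "s \<in> {t \<in> tangents. incident A t}" "t \<in> {t \<in> tangents. incident A t}"
      using A t that by auto
    moreover obtain u where "{t \<in> tangents. incident A t} = {u}"
      using card_tangents_at_oval_point[of A] A by (auto simp: card_1_singleton_iff)
    ultimately show False using that by auto
  qed
  have card_Suc: "card {s \<in> tangents. incident y s} = Suc (card (?others y))" if "y \<in> ?Y" for y
  proof -
    have "{s \<in> tangents. incident y s} = insert t (?others y)" using that t by auto
    then show ?thesis using finite_tangents by simp
  qed
  have "(\<Sum>y\<in>?Y. card (?others y)) = 1 * card (tangents - {t})"
  proof (rule sum_multicount[OF finY], use finite_tangents in simp, rule ballI)
    fix s assume s: "s \<in> tangents - {t}"
    then have "s \<in> lines" "s \<noteq> t" by (auto simp: tangents_def)
    then obtain z where "{y \<in> points. incident y t \<and> incident y s} = {z}"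
      using unique_point[OF t_line, of s] by auto
    moreover have "{y \<in> ?Y. incident y s} = {y \<in> points. incident y t \<and> incident y s}"
      using A_only[OF s] by auto
    ultimately show "card {y \<in> ?Y. incident y s} = 1" by simp
  qed
  also have "\<dots> = (\<Sum>y\<in>?Y. 1)" using t(1) card_tangents finite_tangents cardY by simp
  finally have total: "(\<Sum>y\<in>?Y. 1) = (\<Sum>y\<in>?Y. card (?others y))" by simp
  have "1 \<le> card (?others y)" if y: "y \<in> ?Y" for y
  proof -
    have "y \<in> points" "y \<notin> Q" using y A by auto
    then show ?thesis
      using even_card_tangents_off_oval[of y] card_Suc[OF y] by (cases "card (?others y)") auto
  qed
  moreover have x_Y: "x \<in> ?Y" using x t A by auto
  ultimately have "1 = card (?others x)"
    using sum_mono_inv[OF total _ x_Y finY] by simp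
  then show ?thesis using card_Suc[OF x_Y] by simp
qed

lemma dual_oval: "oval lines points (\<lambda>l x. incident x l) q tangents"
  unfolding oval_def
proof (intro conjI allI impI notI)
  show "tangents \<subseteq> lines" by (auto simp: tangents_def)
  show "card tangents = q + 1" by (rule card_tangents)
  fix S assume S: "S \<subseteq> tangents \<and> card S = 3"
    and "collinear points (\<lambda>l x. incident x l) S"
  then obtain x where x: "x \<in> points" "S \<subseteq> {t \<in> tangents. incident x t}"
    by (auto simp: collinear_def)
  then have "3 \<le> card {t \<in> tangents. incident x t}"
    using S finite_tangents card_mono[OF _ x(2)] by simp
  moreover have "card {t \<in> tangents. incident x t} \<le> 2"
    using card_tangents_at_oval_point[of x] card_tangents_off_oval[of x] x by (cases "x \<in> Q") auto
  ultimately show False by simp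
qed

text \<open>
  The next two lemmas make the passage to the dual an involution, so that a fact about lines, applied
  to the dual plane, is a fact about points of the original configuration.
\<close>

lemma dual_odd_oval: "odd_oval lines points (\<lambda>l x. incident x l) q tangents"
  using dual dual_oval odd_order by (simp add: odd_oval_def odd_oval_axioms_def)

lemma tangents_dual: "odd_oval.tangents points (\<lambda>l x. incident x l) tangents = Q"
proof -
  interpret D: odd_oval lines points "\<lambda>l x. incident x l" q tangents by (rule dual_odd_oval)
  show ?thesis
    unfolding D.tangents_def
    using card_tangents_at_oval_point card_tangents_off_oval oval_points by fastforce
qed

end

section \<open>Deleting a tangent flag\<close>

locale tangent_flag = odd_oval points lines incident q Q
  for points :: "'p set" and lines :: "'l set" and incident and q and Q +
  fixes P :: 'p and T :: 'l
  assumes P_in_oval: "P \<in> Q" and T_tangent: "T \<in> tangents" and P_on_T: "incident P T"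
begin

definition kept_points :: "'p set" where
  "kept_points = {x \<in> points. x \<notin> Q \<and> \<not> incident x T}"

definition kept_lines :: "'l set" where
  "kept_lines = {l \<in> lines. l \<notin> tangents \<and> \<not> incident P l}"

lemma dual_flag: "tangent_flag lines points (\<lambda>l x. incident x l) q tangents T P"
  using dual_odd_oval T_tangent P_in_oval P_on_T
  by (simp add: tangent_flag_def tangent_flag_axioms_def tangents_dual)

lemma kept_lines_dual:
  "tangent_flag.kept_lines points (\<lambda>l x. incident x l) tangents T = kept_points"
proof -
  interpret D: tangent_flag lines points "\<lambda>l x. incident x l" q tangents T P by (rule dual_flag)
  show ?thesis by (simp add: D.kept_lines_def kept_points_def tangents_dual)
qed

lemma kept_points_dual:
  "tangent_flag.kept_points lines (\<lambda>l x. incident x l) tangents P = kept_lines"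
proof -
  interpret D: tangent_flag lines points "\<lambda>l x. incident x l" q tangents T P by (rule dual_flag)
  show ?thesis by (simp add: D.kept_points_def kept_lines_def)
qed

lemma T_line: "T \<in> lines"
  using T_tangent by (simp add: tangents_def)

lemma P_point: "P \<in> points"
  using P_in_oval oval_points by blast

lemma finite_kept: "finite kept_points" "finite kept_lines"
  using finite_points finite_lines by (simp_all add: kept_points_def kept_lines_def)

lemma oval_Int_T: "A \<in> Q \<Longrightarrow> incident A T \<Longrightarrow> A = P"
  using tangency_point_unique T_tangent P_in_oval P_on_T by blast

text \<open>
  The point in which \<open>l\<close> meets \<open>T\<close> is not on the oval, because \<open>P\<close> is the only common point of \<open>T\<close>
  and \<open>Q\<close>. It therefore accounts for one lost point besides those on \<open>Q\<close>.
\<close>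

lemma degree_kept_line:
  assumes l: "l \<in> kept_lines"
  shows "q = card {x \<in> kept_points. incident x l} + card {x \<in> Q. incident x l}"
proof -
  have l': "l \<in> lines" "l \<notin> tangents" "\<not> incident P l" using l by (auto simp: kept_lines_def)
  then have "l \<noteq> T" using T_tangent by blast
  then obtain w where w: "{x \<in> points. incident x l \<and> incident x T} = {w}"
    using unique_point[OF l'(1) T_line] by auto
  have "w \<notin> Q" using w l' oval_Int_T[of w] by auto
  then have disj: "w \<notin> {x \<in> kept_points. incident x l} \<union> {x \<in> Q. incident x l}"
    using w by (auto simp: kept_points_def)
  have "{x \<in> points. incident x l} =
      insert w ({x \<in> kept_points. incident x l} \<union> {x \<in> Q. incident x l})"
    using w oval_points by (auto simp: kept_points_def)
  then have "q + 1 = Suc (card ({x \<in> kept_points. incident x l} \<union> {x \<in> Q. incident x l}))"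
    using card_points_on_line[OF l'(1)] disj finite_kept finite_oval by simp
  also have "card ({x \<in> kept_points. incident x l} \<union> {x \<in> Q. incident x l}) =
      card {x \<in> kept_points. incident x l} + card {x \<in> Q. incident x l}"
    using finite_points finite_oval by (intro card_Un_disjoint) (auto simp: kept_points_def)
  finally show ?thesis by simp
qed

text \<open>
  The \<open>q + 1\<close> tangents and the \<open>q + 1\<close> lines through \<open>P\<close> have only \<open>T\<close> in common.
\<close>

lemma card_kept_lines: "card kept_lines = q * (q - 1)"
proof -
  let ?pencil = "{l \<in> lines. incident P l}"
  have "card {t \<in> tangents. incident P t} = 1"
    by (rule card_tangents_at_oval_point[OF P_in_oval])
  moreover have "tangents \<inter> ?pencil = {t \<in> tangents. incident P t}"
    by (auto simp: tangents_def)
  ultimately have "card (tangents \<inter> ?pencil) = 1" by simp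
  moreover have "card tangents + card ?pencil = card (tangents \<union> ?pencil) + card (tangents \<inter> ?pencil)"
    using finite_tangents finite_lines by (intro card_Un_Int) auto
  ultimately have "card (tangents \<union> ?pencil) = 2 * q + 1"
    using card_tangents card_lines_through_point[OF P_point] by simp
  moreover have "kept_lines = lines - (tangents \<union> ?pencil)"
    by (auto simp: kept_lines_def)
  moreover have "tangents \<union> ?pencil \<subseteq> lines"
    by (auto simp: tangents_def)
  ultimately have "card kept_lines = q\<^sup>2 + q + 1 - (2 * q + 1)"
    using finite_lines card_lines by (metis card_Diff_subset finite_subset)
  then show ?thesis
    by (simp add: power2_eq_square diff_mult_distrib2)
qed

text \<open>Only the tangent at \<open>A\<close> and the secant joining \<open>A\<close> to \<open>P\<close> are lost.\<close>

lemma card_kept_lines_through_oval_point: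
  assumes A: "A \<in> Q - {P}"
  shows "card {l \<in> kept_lines. incident A l} = q - 1"
proof -
  have A_pt: "A \<in> points" using A oval_points by blast
  obtain t where t: "{t \<in> tangents. incident A t} = {t}"
    using card_tangents_at_oval_point[of A] A by (auto simp: card_1_singleton_iff)
  obtain m where m: "{l \<in> lines. incident A l \<and> incident P l} = {m}"
    using card_common_lines[OF A_pt P_point] A by (auto simp: card_1_singleton_iff)
  have t_line: "t \<in> lines" using t by (auto simp: tangents_def)
  have "t \<noteq> m"
  proof
    assume "t = m"
    then have "t \<in> tangents" "incident A t" "incident P t"
      using t m by auto
    then show False using tangency_point_unique A P_in_oval by blast
  qed
  have "{l \<in> kept_lines. incident A l} = {l \<in> lines. incident A l} - {t, m}"
    using t m by (auto simp: kept_lines_def)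
  moreover have "{t, m} \<subseteq> {l \<in> lines. incident A l}"
    using t m t_line by blast
  ultimately show ?thesis
    using card_lines_through_point[OF A_pt] \<open>t \<noteq> m\<close> by (simp add: card_Diff_subset)
qed

text \<open>
  Each of the \<open>q\<close> oval points other than \<open>P\<close> lies on \<open>q - 1\<close> kept lines, and each kept secant is
  counted twice among these incidences. So half of the \<open>q(q - 1)\<close> kept lines are secants.
\<close>

lemma card_kept_secants_passants:
  "2 * card {l \<in> kept_lines. card {x \<in> Q. incident x l} = 2} = q * (q - 1)"
  "2 * card {l \<in> kept_lines. card {x \<in> Q. incident x l} = 0} = q * (q - 1)"
proof -
  let ?n = "\<lambda>l. card {x \<in> Q. incident x l}"
  let ?sec = "{l \<in> kept_lines. ?n l = 2}" and ?pas = "{l \<in> kept_lines. ?n l = 0}"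
  have n: "?n l \<in> {0, 2}" if "l \<in> kept_lines" for l
    using that nontangent_meets_oval by (simp add: kept_lines_def)
  have "(\<Sum>l\<in>kept_lines. card {x \<in> Q - {P}. incident x l}) = (q - 1) * card (Q - {P})"
    using card_kept_lines_through_oval_point finite_kept finite_oval
    by (intro sum_multicount) auto
  also have "\<dots> = q * (q - 1)"
    using card_oval P_in_oval finite_oval by simp
  also have "(\<Sum>l\<in>kept_lines. card {x \<in> Q - {P}. incident x l}) = (\<Sum>l\<in>kept_lines. ?n l)"
    by (intro sum.cong refl arg_cong[where f = card]) (auto simp: kept_lines_def)
  also have "\<dots> = (\<Sum>l\<in>kept_lines. if ?n l = 2 then 2 else 0)"
    using n by (intro sum.cong) auto
  also have "\<dots> = 2 * card ?sec"
    using finite_kept by (simp add: sum.If_cases Int_def)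
  finally show sec: "2 * card ?sec = q * (q - 1)" .
  have "kept_lines = ?sec \<union> ?pas"
    using n by blast
  also have "card \<dots> = card ?sec + card ?pas"
    using finite_kept by (intro card_Un_disjoint) auto
  finally have "card kept_lines = card ?sec + card ?pas" .
  then show "2 * card ?pas = q * (q - 1)"
    using sec card_kept_lines by simp
qed

text \<open>The kept secants have degree \<open>q - 2\<close> and the kept lines that miss the oval have degree \<open>q\<close>.\<close>

lemma degrees_kept_lines:
  assumes "2 \<le> q"
  shows "\<And>l. l \<in> kept_lines \<Longrightarrow> card {x \<in> kept_points. incident x l} \<in> {q - 2, q}"
    and "2 * card {l \<in> kept_lines. card {x \<in> kept_points. incident x l} = q - 2} = q * (q - 1)"
    and "2 * card {l \<in> kept_lines. card {x \<in> kept_points. incident x l} = q} = q * (q - 1)"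
proof -
  have n: "card {x \<in> Q. incident x l} \<in> {0, 2}" if "l \<in> kept_lines" for l
    using that nontangent_meets_oval by (simp add: kept_lines_def)
  show "card {x \<in> kept_points. incident x l} \<in> {q - 2, q}" if "l \<in> kept_lines" for l
    using degree_kept_line[OF that] n[OF that] by auto
  have "{l \<in> kept_lines. card {x \<in> kept_points. incident x l} = q - 2} =
      {l \<in> kept_lines. card {x \<in> Q. incident x l} = 2}"
  proof (intro Collect_cong conj_cong refl)
    fix l assume "l \<in> kept_lines"
    from degree_kept_line[OF this] n[OF this] assms
    show "card {x \<in> kept_points. incident x l} = q - 2 \<longleftrightarrow> card {x \<in> Q. incident x l} = 2"
      by auto
  qed
  then show "2 * card {l \<in> kept_lines. card {x \<in> kept_points. incident x l} = q - 2} = q * (q - 1)"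
    using card_kept_secants_passants(1) by simp
  have "{l \<in> kept_lines. card {x \<in> kept_points. incident x l} = q} =
      {l \<in> kept_lines. card {x \<in> Q. incident x l} = 0}"
  proof (intro Collect_cong conj_cong refl)
    fix l assume "l \<in> kept_lines"
    from degree_kept_line[OF this]
    show "card {x \<in> kept_points. incident x l} = q \<longleftrightarrow> card {x \<in> Q. incident x l} = 0"
      by linarith
  qed
  then show "2 * card {l \<in> kept_lines. card {x \<in> kept_points. incident x l} = q} = q * (q - 1)"
    using card_kept_secants_passants(2) by simp
qed

lemma degrees_kept_points:
  assumes "2 \<le> q"
  shows "\<And>x. x \<in> kept_points \<Longrightarrow> card {l \<in> kept_lines. incident x l} \<in> {q - 2, q}"
    and "2 * card {x \<in> kept_points. card {l \<in> kept_lines. incident x l} = q - 2} = q * (q - 1)"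
    and "2 * card {x \<in> kept_points. card {l \<in> kept_lines. incident x l} = q} = q * (q - 1)"
proof -
  interpret D: tangent_flag lines points "\<lambda>l x. incident x l" q tangents T P by (rule dual_flag)
  note D = D.degrees_kept_lines[OF assms, unfolded kept_lines_dual kept_points_dual]
  show "\<And>x. x \<in> kept_points \<Longrightarrow> card {l \<in> kept_lines. incident x l} \<in> {q - 2, q}"
    by (rule D(1))
  show "2 * card {x \<in> kept_points. card {l \<in> kept_lines. incident x l} = q - 2} = q * (q - 1)"
    by (rule D(2))
  show "2 * card {x \<in> kept_points. card {l \<in> kept_lines. incident x l} = q} = q * (q - 1)"
    by (rule D(3))
qed

lemma card_kept_points: "card kept_points = q * (q - 1)"
proof -
  interpret D: tangent_flag lines points "\<lambda>l x. incident x l" q tangents T P by (rule dual_flag)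
  show ?thesis using D.card_kept_lines by (simp add: kept_lines_dual)
qed

text \<open>
  One side \<open>m\<close> is chosen to miss the oval, so that its intersection \<open>w\<close> with \<open>T\<close> is its only deleted
  point. With \<open>x\<close> on \<open>m\<close>, a second line \<open>l\<close> through \<open>x\<close>, and another point \<open>y\<close> on \<open>l\<close>, it
  suffices to find a kept line through \<open>y\<close> that differs from \<open>l\<close> and from the join of \<open>y\<close> and \<open>w\<close>: it
  meets \<open>m\<close> in a kept point. Such a line exists because \<open>y\<close> has degree at least \<open>q - 2 \<ge> 3\<close>.
\<close>

lemma kept_triangle:
  assumes "5 \<le> q"
  obtains x y z k l m where "x \<in> kept_points" "y \<in> kept_points" "z \<in> kept_points"
    "k \<in> kept_lines" "l \<in> kept_lines" "m \<in> kept_lines"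
    "x \<noteq> y" "y \<noteq> z" "z \<noteq> x" "k \<noteq> l" "l \<noteq> m" "m \<noteq> k"
    "incident x l" "incident y l" "incident y k" "incident z k" "incident z m" "incident x m"
proof -
  have q2: "2 \<le> q" using assms by simp
  have another: "\<exists>a\<in>A. a \<notin> B" if "finite B" "card B < card A" for A B :: "'c set"
    using that by (meson card_mono linorder_not_less subsetI)
  have line_deg: "3 \<le> card {x \<in> kept_points. incident x l}" if "l \<in> kept_lines" for l
    using degrees_kept_lines(1)[OF q2 that] assms by auto
  have point_deg: "3 \<le> card {l \<in> kept_lines. incident x l}" if "x \<in> kept_points" for x
    using degrees_kept_points(1)[OF q2 that] assms by auto
  have pts: "x \<in> points" if "x \<in> kept_points" for x
    using that by (simp add: kept_points_def)
  have lns: "l \<in> lines" if "l \<in> kept_lines" for l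
    using that by (simp add: kept_lines_def)
  have "{l \<in> kept_lines. card {x \<in> Q. incident x l} = 0} \<noteq> {}"
    using card_kept_secants_passants(2) assms by (intro notI) simp
  then obtain m where m: "m \<in> kept_lines" "{x \<in> Q. incident x m} = {}"
    using finite_oval by auto
  have "m \<noteq> T" using m T_tangent by (auto simp: kept_lines_def)
  then obtain w where w: "w \<in> points" "incident w m" "incident w T"
    "\<And>v. v \<in> points \<Longrightarrow> incident v m \<Longrightarrow> incident v T \<Longrightarrow> v = w"
    using unique_point[OF lns[OF m(1)] T_line] by blast
  obtain x where x: "x \<in> kept_points" "incident x m"
    using another[of "{}" "{x \<in> kept_points. incident x m}"] line_deg[OF m(1)] by auto
  obtain l where l: "l \<in> kept_lines" "incident x l" "l \<noteq> m"
    using another[of "{m}" "{l \<in> kept_lines. incident x l}"] point_deg[OF x(1)] by auto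
  obtain y where y: "y \<in> kept_points" "incident y l" "y \<noteq> x"
    using another[of "{x}" "{y \<in> kept_points. incident y l}"] line_deg[OF l(1)] by auto
  have y_m: "\<not> incident y m"
    using partial_linear[of x y l m] x y l m pts lns by blast
  then obtain j where j: "\<And>k. k \<in> lines \<Longrightarrow> incident y k \<Longrightarrow> incident w k \<Longrightarrow> k = j"
    using unique_line[OF pts[OF y(1)] w(1)] w(2) by blast
  have "card {l, j} \<le> 2" by (simp add: card_insert_if)
  then obtain k where k: "k \<in> kept_lines" "incident y k" "k \<noteq> l" "k \<noteq> j"
    using another[of "{l, j}" "{k \<in> kept_lines. incident y k}"] point_deg[OF y(1)] by auto
  have "k \<noteq> m" using k y_m by blast
  then obtain z where z: "z \<in> points" "incident z k" "incident z m"
    using unique_point[OF lns[OF k(1)] lns[OF m(1)]] by blast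
  have "z \<noteq> w" using j[OF lns[OF k(1)] k(2)] k(4) z(2) by blast
  then have "\<not> incident z T" using w(4) z by blast
  moreover have "z \<notin> Q" using m(2) z(3) by blast
  ultimately have z_kept: "z \<in> kept_points"
    using z(1) by (simp add: kept_points_def)
  have "z \<noteq> y" using z y_m by blast
  moreover have "z \<noteq> x"
    using partial_linear[of x y l k] x y l k z pts lns by blast
  ultimately show thesis
    using that[OF x(1) y(1) z_kept k(1) l(1) m(1) y(3)[symmetric] _ _ k(3) l(3)
        \<open>k \<noteq> m\<close>[symmetric] l(2) y(2) k(2) z(2,3) x(2)]
    by blast
qed

end

section \<open>The balanced biregular graph\<close>

theorem theorem6p9:
  fixes r :: nat
    and points :: "'p set" and lines :: "'l set"
    and incident :: "'p \<Rightarrow> 'l \<Rightarrow> bool" and Q :: "'p set"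
  assumes "odd (r + 2)" and "r + 2 > 3"
    and "projective_plane points lines incident (r + 2)"
    and "oval points lines incident (r + 2) Q"
  shows "\<exists>G :: (nat, nat \<times> nat) pre_digraph.
           babi_graph r (r + 2) 6 G \<and> order G = 2 * (r\<^sup>2 + 3 * r + 2)"
proof -
  let ?q = "r + 2"
  interpret O: odd_oval points lines incident ?q Q
    using assms by (simp add: odd_oval_def odd_oval_axioms_def)
  have q5: "5 \<le> ?q" using assms(1,2) by presburger
  have "Q \<noteq> {}" using O.card_oval by auto
  then obtain P where P: "P \<in> Q" by blast
  then obtain T where "{t \<in> O.tangents. incident P t} = {T}"
    using O.card_tangents_at_oval_point by (metis (no_types, lifting) card_1_singletonE)
  then interpret F: tangent_flag points lines incident ?q Q P T
    using P by unfold_locales auto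
  obtain f' :: "'p \<Rightarrow> nat" where f': "inj_on f' F.kept_points"
    using finite_imp_inj_to_nat_seg[OF F.finite_kept(1)] by blast
  obtain g' :: "'l \<Rightarrow> nat" where g': "inj_on g' F.kept_lines"
    using finite_imp_inj_to_nat_seg[OF F.finite_kept(2)] by blast
  \<comment> \<open>Points go to even numbers and lines to odd numbers, so the two sides are disjoint.\<close>
  define f where "f x = 2 * f' x" for x
  define g where "g l = 2 * g' l + 1" for l
  interpret G: finite_incidence F.kept_points F.kept_lines incident f g
  proof
    show "f ` F.kept_points \<inter> g ` F.kept_lines = {}"
      by (auto simp: f_def g_def) presburger
  qed (use F.finite_kept f' g' in \<open>auto simp: f_def g_def inj_on_def\<close>)
  have girth: "girth G.G = 6"
  proof -
    obtain x y z k l m where "x \<in> F.kept_points" "y \<in> F.kept_points" "z \<in> F.kept_points"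
      "k \<in> F.kept_lines" "l \<in> F.kept_lines" "m \<in> F.kept_lines"
      "x \<noteq> y" "y \<noteq> z" "z \<noteq> x" "k \<noteq> l" "l \<noteq> m" "m \<noteq> k"
      "incident x l" "incident y l" "incident y k" "incident z k" "incident z m" "incident x m"
      using F.kept_triangle[OF q5] by blast
    moreover have "x = y \<or> l = m" if "x \<in> F.kept_points" "y \<in> F.kept_points"
      "l \<in> F.kept_lines" "m \<in> F.kept_lines"
      "incident x l" "incident y l" "incident x m" "incident y m" for x y l m
      using that O.partial_linear by (auto simp: F.kept_points_def F.kept_lines_def)
    ultimately show ?thesis
      using G.girth_eq_6 by presburger
  qed
  have q2: "2 \<le> ?q" by simp
  note deg_l = F.degrees_kept_lines[OF q2, simplified] and deg_p = F.degrees_kept_points[OF q2, simplified]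
  have card_r: "card {v \<in> verts G.G. out_degree G.G v = r} = ?q * (?q - 1)"
    using deg_l(2) deg_p(2) by (simp add: G.card_vertices_of_degree)
  have card_s: "card {v \<in> verts G.G. out_degree G.G v = ?q} = ?q * (?q - 1)"
    using deg_l(3) deg_p(3) by (simp add: G.card_vertices_of_degree)
  have attained: "d \<in> out_degree G.G ` verts G.G"
    if "card {v \<in> verts G.G. out_degree G.G v = d} = ?q * (?q - 1)" for d
  proof -
    have "0 < card {v \<in> verts G.G. out_degree G.G v = d}"
      using that by simp
    then obtain v where "v \<in> {v \<in> verts G.G. out_degree G.G v = d}"
      by (metis (no_types, lifting) card_gt_0_iff ex_in_conv)
    then show ?thesis by auto
  qed
  have "out_degree G.G ` verts G.G \<subseteq> {r, ?q}"
    using deg_l(1) deg_p(1) by (auto simp: G.out_degree_image)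
  moreover have "r \<in> out_degree G.G ` verts G.G" "?q \<in> out_degree G.G ` verts G.G"
    by (rule attained[OF card_r], rule attained[OF card_s])
  ultimately have "out_degree G.G ` verts G.G = {r, ?q}"
    by blast
  then have "babi_graph r ?q 6 G.G"
    using G.graph girth card_r card_s q5 by (simp add: babi_graph_def numeral_eq_enat)
  moreover have "order G.G = 2 * (r\<^sup>2 + 3 * r + 2)"
    by (simp add: G.order F.card_kept_points F.card_kept_lines power2_eq_square algebra_simps)
  ultimately show ?thesis by blast
qed

end
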